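(* Let $\mathbb{F}$ be an algebraically closed field of arbitrary characteristic. The automorphism group of any two-dimensional simple $\mathbb{F}$-algebra is finite.
   Context: An algebra is a vector space with a bilinear multiplication, not necessarily associative, commutative or unital. An algebra is simple if its multiplication is not identically zero and it has no two-sided ideals other than $0$ and itself. The automorphism group of $\mathcal{A}$ is the group of invertible $\mathbb{F}$-linear maps $g:\mathcal{A}\to\mathcal{A}$ with $g(ab)=g(a)g(b)$. *)

theory Defs
  imports "HOL-Computational_Algebra.Polynomial" "HOL-Algebra.Group"
begin

text \<open>The underlying space is the whole type \<open>'b\<close>; the product need not be associative,
  commutative or unital.\<close>

locale nonassoc_algebra = vector_space scale
  for scale :: "'a::field \<Rightarrow> 'b::ab_group_add \<Rightarrow> 'b" (infixr \<open>*s\<close> 75) +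
  fixes prod :: "'b \<Rightarrow> 'b \<Rightarrow> 'b" (infixl \<open>\<star>\<close> 70)
  assumes linear_right: "Vector_Spaces.linear scale scale (\<lambda>y. x \<star> y)"
    and linear_left: "Vector_Spaces.linear scale scale (\<lambda>x. x \<star> y)"
begin

definition two_sided_ideal :: "'b set \<Rightarrow> bool" where
  "two_sided_ideal I \<longleftrightarrow> subspace I \<and> (\<forall>x\<in>I. \<forall>a. a \<star> x \<in> I \<and> x \<star> a \<in> I)"

definition simple :: bool where
  "simple \<longleftrightarrow> (\<exists>x y. x \<star> y \<noteq> 0) \<and> (\<forall>I. two_sided_ideal I \<longrightarrow> I = {0} \<or> I = UNIV)"

definition automorphism :: "('b \<Rightarrow> 'b) \<Rightarrow> bool" where
  "automorphism g \<longleftrightarrow> Vector_Spaces.linear scale scale g \<and> bij g \<and>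
     (\<forall>x y. g (x \<star> y) = g x \<star> g y)"

definition automorphism_group :: "('b \<Rightarrow> 'b) monoid" where
  "automorphism_group = \<lparr>carrier = {g. automorphism g}, monoid.mult = (\<circ>), one = id\<rparr>"

lemma automorphism_id: "automorphism id"
  by (simp add: automorphism_def linear_id)

lemma automorphism_comp:
  "automorphism g \<Longrightarrow> automorphism h \<Longrightarrow> automorphism (g \<circ> h)"
  unfolding automorphism_def
  by (auto intro: Vector_Spaces.linear_compose bij_comp)

lemma automorphism_inv:
  assumes "automorphism g"
  shows "automorphism (inv_into UNIV g)"
proof -
  from assms have lin: "Vector_Spaces.linear scale scale g" and bij: "bij g"
    and hom: "\<And>x y. g (x \<star> y) = g x \<star> g y"
    unfolding automorphism_def by auto
  interpret g: Vector_Spaces.linear scale scale g by fact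
  have gi: "g (inv_into UNIV g x) = x" for x using bij by (simp add: bij_is_surj surj_f_inv_f)
  have inj: "g x = g y \<Longrightarrow> x = y" for x y using bij by (auto simp: bij_def inj_def)
  have "Vector_Spaces.linear scale scale (inv_into UNIV g)"
    unfolding module_hom_iff_linear[symmetric]
    by (unfold_locales; rule inj; simp add: gi g.add g.scale)
  moreover have "inv_into UNIV g (x \<star> y) = inv_into UNIV g x \<star> inv_into UNIV g y" for x y
    by (rule inj) (simp add: gi hom)
  ultimately show ?thesis
    unfolding automorphism_def using bij by (auto simp: bij_imp_bij_inv)
qed

lemma group_automorphism_group: "Group.group automorphism_group"
proof (rule groupI)
  fix g assume "g \<in> carrier automorphism_group"
  then have g: "automorphism g" by (simp add: automorphism_group_def)
  then have "inv_into UNIV g \<circ> g = id" by (simp add: automorphism_def bij_is_inj)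
  then show "\<exists>h\<in>carrier automorphism_group.
      h \<otimes>\<^bsub>automorphism_group\<^esub> g = \<one>\<^bsub>automorphism_group\<^esub>"
    using automorphism_inv[OF g] by (auto simp: automorphism_group_def)
qed (auto simp: automorphism_group_def automorphism_id intro: automorphism_comp)

end

end

theory Submission
  imports Defs
begin

text \<open>
  The proof has two independent halves.

  First, over any field, only finitely many automorphisms map a given line \<open>Fu\<close> to itself
  (\<open>finite_line_stabilizer\<close>). In a basis \<open>u, v\<close> such a \<open>g\<close> is triangular with eigenvalues
  \<open>a\<close> on \<open>Fu\<close> and \<open>b\<close> on the quotient by \<open>Fu\<close>. By simplicity \<open>Fu\<close> is not an ideal, so one of
  \<open>uu\<close>, \<open>uv\<close>, \<open>vu\<close> has a nonzero image in the quotient; comparing how \<open>g\<close> acts on it gives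
  \<open>b = a\<^sup>2\<close> or \<open>a = 1\<close>. If \<open>a \<noteq> b\<close>, the same argument for the other eigenline gives
  \<open>a = b\<^sup>2\<close> or \<open>b = 1\<close>. In every case \<open>a\<close> and \<open>b\<close> are sixth roots of unity, so there are finitely
  many pairs \<open>(a, b)\<close>, and automorphisms with equal pairs differ by a unipotent one,
  \<open>u \<mapsto> u\<close>, \<open>v \<mapsto> v + tu\<close>. Multiplicativity determines \<open>t\<close> if it is nonzero
  (\<open>unipotent_parameter_unique\<close>), so there are at most two of these.

  Second, over an algebraically closed field, there is a nonempty finite set of lines that all
  automorphisms permute. The candidates are the lines \<open>Fx\<close> with \<open>xx \<in> Fx\<close>. If some \<open>v\<close> has
  \<open>vv \<notin> Fv\<close>, every such line is spanned by some \<open>u + tv\<close> with \<open>t\<close> a root of a cubic polynomial,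
  which has a root and finitely many of them. Otherwise \<open>xx = \<lambda>(x)x\<close> for a linear form \<open>\<lambda>\<close>. If
  \<open>\<lambda>\<close> were zero, the product would be alternating and all products would lie on the line
  \<open>F(uv)\<close>, an ideal; so the kernel of \<open>\<lambda>\<close>, which consists of the elements of square zero, is a
  line fixed by every automorphism.

  An automorphism group that permutes finitely many lines, one of which has a finite stabilizer, is
  finite.
\<close>

section \<open>Automorphisms of nonassociative algebras\<close>

context nonassoc_algebra
begin

lemma prod_add_right: "x \<star> (y + z) = x \<star> y + x \<star> z"
  and prod_scale_right: "x \<star> (c *s y) = c *s (x \<star> y)"
proof -
  interpret r: Vector_Spaces.linear scale scale "\<lambda>y. x \<star> y" by (rule linear_right)
  show "x \<star> (y + z) = x \<star> y + x \<star> z" "x \<star> (c *s y) = c *s (x \<star> y)"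
    by (rule r.add, rule r.scale)
qed

lemma prod_add_left: "(x + y) \<star> z = x \<star> z + y \<star> z"
  and prod_scale_left: "(c *s x) \<star> z = c *s (x \<star> z)"
proof -
  interpret l: Vector_Spaces.linear scale scale "\<lambda>x. x \<star> z" by (rule linear_left)
  show "(x + y) \<star> z = x \<star> z + y \<star> z" "(c *s x) \<star> z = c *s (x \<star> z)"
    by (rule l.add, rule l.scale)
qed

lemmas prod_bilinear = prod_add_right prod_scale_right prod_add_left prod_scale_left

lemma automorphismD:
  assumes "automorphism g"
  shows "g (x + y) = g x + g y" "g (c *s x) = c *s g x" "g (x \<star> y) = g x \<star> g y" "bij g"
    "g (x - y) = g x - g y"
proof -
  interpret g: Vector_Spaces.linear scale scale g
    using assms by (simp add: automorphism_def)
  show "g (x + y) = g x + g y" "g (c *s x) = c *s g x" by (rule g.add, rule g.scale)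
  show "g (x - y) = g x - g y" by (rule g.diff)
  show "g (x \<star> y) = g x \<star> g y" "bij g" using assms by (auto simp: automorphism_def)
qed

lemma automorphism_0_iff: "automorphism g \<Longrightarrow> g x = 0 \<longleftrightarrow> x = 0"
proof -
  assume g: "automorphism g"
  have "g 0 = 0" using automorphismD(2)[OF g, of 0 0] by simp
  moreover have "inj g" using automorphismD(4)[OF g] by (rule bij_is_inj)
  ultimately show ?thesis by (metis injD)
qed

lemma span_singleton_iff: "x \<in> span {u} \<longleftrightarrow> (\<exists>k. x = k *s u)"
  by (auto simp: span_singleton)

lemma span_scaled_singleton: "k \<noteq> 0 \<Longrightarrow> span {k *s u} = span {u}"
proof -
  assume "k \<noteq> 0"
  then have "c *s u = (c / k) *s k *s u" for c by simp
  then have "c *s u \<in> span {k *s u}" for c unfolding span_singleton_iff by blast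
  then show ?thesis by (auto simp: span_singleton)
qed

text \<open>Whether \<open>xx \<in> Fx\<close> depends only on the line \<open>Fx\<close>, and automorphisms preserve the property. It thus
  singles out a set of lines that the automorphism group permutes.\<close>

lemma square_in_line_scale:
  assumes "x \<star> x \<in> span {x}"
  shows "(k *s x) \<star> (k *s x) \<in> span {k *s x}"
proof -
  obtain l where "x \<star> x = l *s x" using assms by (auto simp: span_singleton)
  then have "(k *s x) \<star> (k *s x) = (k * l) *s k *s x"
    by (simp add: prod_bilinear mult.commute mult.left_commute)
  then show ?thesis unfolding span_singleton_iff by blast
qed

lemma automorphism_square_in_line:
  assumes "automorphism g" "x \<star> x \<in> span {x}"
  shows "g x \<star> g x \<in> span {g x}"
proof -
  obtain k where "x \<star> x = k *s x" using assms(2) by (auto simp: span_singleton)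
  then have "g x \<star> g x = k *s g x" using assms(1) by (metis automorphismD(2,3))
  then show ?thesis by (auto simp: span_singleton)
qed

text \<open>The orbit-stabilizer argument without group actions: each fibre of \<open>\<phi>\<close> lies in a left translate of
  the finite set \<open>K\<close>, so an infinite \<open>G\<close> would contradict the pigeonhole principle.\<close>

lemma finite_automorphisms_by_fibres:
  assumes G: "\<And>g. g \<in> G \<Longrightarrow> automorphism g"
    and img: "finite (\<phi> ` G)"
    and K: "finite K"
    and fib: "\<And>g h. g \<in> G \<Longrightarrow> h \<in> G \<Longrightarrow> \<phi> g = \<phi> h \<Longrightarrow> inv_into UNIV g \<circ> h \<in> K"
  shows "finite G"
proof (rule ccontr)
  assume "infinite G"
  then obtain g where g: "g \<in> G" "infinite {h \<in> G. \<phi> h = \<phi> g}"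
    using pigeonhole_infinite[OF _ img] by blast
  have "{h \<in> G. \<phi> h = \<phi> g} \<subseteq> (\<lambda>k. g \<circ> k) ` K"
  proof
    fix h assume "h \<in> {h \<in> G. \<phi> h = \<phi> g}"
    then have "inv_into UNIV g \<circ> h \<in> K" using fib[OF g(1), of h] by simp
    moreover have "g \<circ> (inv_into UNIV g \<circ> h) = h"
      using automorphismD(4)[OF G[OF g(1)]] by (auto simp: fun_eq_iff bij_is_surj surj_f_inv_f)
    ultimately show "h \<in> (\<lambda>k. g \<circ> k) ` K" by (metis imageI)
  qed
  with g(2) K show False using finite_surj by blast
qed

end

section \<open>Bases of a simple plane algebra\<close>

locale simple_plane_algebra = nonassoc_algebra scale prod
  for scale :: "'a::field \<Rightarrow> 'b::ab_group_add \<Rightarrow> 'b" (infixr \<open>*s\<close> 75)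
    and prod :: "'b \<Rightarrow> 'b \<Rightarrow> 'b" (infixl \<open>\<star>\<close> 70) +
  assumes dim_eq_2: "dim (UNIV :: 'b set) = 2"
    and simple: "simple"
begin

text \<open>In dimension 2 this says that \<open>u, v\<close> is an ordered basis. The asymmetric form is the one in which
  a basis is found: extend a nonzero \<open>u\<close> by anything outside its line.\<close>

definition frame :: "'b \<Rightarrow> 'b \<Rightarrow> bool" where
  "frame u v \<longleftrightarrow> u \<noteq> 0 \<and> v \<notin> span {u}"

lemma frame_independent:
  assumes "frame u v"
  shows "independent {u, v}" "u \<noteq> v"
proof -
  show "independent {u, v}"
    using assms unfolding frame_def insert_commute[of u v]
    by (intro independent_insertI independent_empty) auto
  show "u \<noteq> v" using assms span_base[of u "{u}"] by (auto simp: frame_def)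
qed

lemma frame_coordinates:
  assumes "frame u v"
  obtains a b where "x = a *s u + b *s v"
proof -
  have ind: "independent {u, v}" and ne: "u \<noteq> v"
    using frame_independent[OF assms] .
  obtain B where B: "{u, v} \<subseteq> B" "independent B" "UNIV \<subseteq> span B"
    by (rule maximal_independent_subset_extend[OF subset_UNIV ind])
  have "card B = 2" using basis_card_eq_dim[OF subset_UNIV B(3,2)] dim_eq_2 by simp
  moreover have "card {u, v} = 2" using ne by simp
  moreover have "finite B" using \<open>card B = 2\<close> by (simp add: card_ge_0_finite)
  ultimately have "B = {u, v}" using card_subset_eq[OF _ B(1)] by simp
  then have "x \<in> span {u, v}" using B(3) by auto
  then obtain a b where "x - a *s u - b *s v = 0"
    unfolding span_breakdown_eq span_empty by auto
  then have "x = a *s u + b *s v" by (simp add: algebra_simps)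
  then show ?thesis by (rule that)
qed

lemma frame_eq_iff:
  assumes "frame u v"
  shows "a *s u + b *s v = a' *s u + b' *s v \<longleftrightarrow> a = a' \<and> b = b'"
proof
  assume eq: "a *s u + b *s v = a' *s u + b' *s v"
  then have 1: "(b - b') *s v = (a' - a) *s u"
    by (simp add: scale_left_diff_distrib algebra_simps)
  have "b = b'"
  proof (rule ccontr)
    assume "b \<noteq> b'"
    then have "v = (inverse (b - b') * (a' - a)) *s u"
      using arg_cong[OF 1, of "\<lambda>x. inverse (b - b') *s x"] by simp
    then show False using assms by (auto simp: frame_def span_singleton)
  qed
  with eq show "a = a' \<and> b = b'" using assms by (simp add: frame_def)
qed auto

lemma frame_sym: "frame u v \<Longrightarrow> frame v u"
proof -
  assume f: "frame u v"
  have "v \<noteq> 0" using f span_zero[of "{u}"] by (auto simp: frame_def)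
  moreover have "u \<noteq> k *s v" for k
    using frame_eq_iff[OF f, of 1 0 0 k] by simp
  ultimately show ?thesis by (simp add: frame_def span_singleton_iff)
qed

lemma span_singleton_neq_UNIV: "span {u} \<noteq> UNIV"
proof
  assume eq: "span {u} = UNIV"
  have "dim (span {u}) \<le> card {u}"
    by (rule dim_le_card) simp_all
  then show False unfolding eq dim_eq_2 by simp
qed

lemma frame_exists: "u \<noteq> 0 \<Longrightarrow> \<exists>v. frame u v"
  using span_singleton_neq_UNIV[of u] by (auto simp: frame_def)

lemma line_not_ideal:
  assumes "u \<noteq> 0"
  shows "\<not> two_sided_ideal (span {u})"
proof
  assume "two_sided_ideal (span {u})"
  then have "span {u} = {0}"
    using simple span_singleton_neq_UNIV unfolding simple_def by blast
  then show False using assms span_base[of u "{u}"] by auto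
qed

text \<open>Otherwise multiplication by either basis vector, on either side, would map \<open>Fu\<close> into itself and
  make it an ideal.\<close>

lemma product_leaves_line:
  assumes "frame u v"
  shows "u \<star> u \<notin> span {u} \<or> u \<star> v \<notin> span {u} \<or> v \<star> u \<notin> span {u}"
proof (rule ccontr)
  assume "\<not> ?thesis"
  then have *: "u \<star> u \<in> span {u}" "u \<star> v \<in> span {u}" "v \<star> u \<in> span {u}" by auto
  have "a \<star> x \<in> span {u} \<and> x \<star> a \<in> span {u}" if xu: "x \<in> span {u}" for x a
  proof -
    obtain k where x: "x = k *s u" using xu by (auto simp: span_singleton)
    obtain c d where a: "a = c *s u + d *s v" using frame_coordinates[OF assms] .
    show ?thesis unfolding x a prod_bilinear
      by (intro conjI span_scale span_add *)
  qed
  then have "two_sided_ideal (span {u})"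
    unfolding two_sided_ideal_def using subspace_span by blast
  then show False using line_not_ideal assms by (simp add: frame_def)
qed

text \<open>A line that contains all products is an ideal.\<close>

lemma products_not_in_line:
  assumes "\<And>x y. x \<star> y \<in> span {z}"
  shows False
proof -
  have "z \<noteq> 0" using simple assms unfolding simple_def by (auto simp: span_singleton)
  moreover have "two_sided_ideal (span {z})"
    unfolding two_sided_ideal_def using assms subspace_span by blast
  ultimately show False using line_not_ideal by blast
qed

section \<open>Finiteness of line stabilizers\<close>

text \<open>On the quotient by \<open>Fu\<close> the map \<open>g\<close> multiplies by \<open>b\<close>. If \<open>uu \<notin> Fu\<close>, its image there is also
  multiplied by \<open>a\<^sup>2\<close>, whence \<open>b = a\<^sup>2\<close>. If \<open>uu \<in> Fu\<close>, then \<open>uv\<close> or \<open>vu\<close> has a nonzero image,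
  which is also multiplied by \<open>ab\<close>, whence \<open>a = 1\<close>. In the computation \<open>c2\<close>, \<open>d2\<close>, \<open>e2\<close> are these
  images.\<close>

lemma triangular_eigenvalues:
  assumes g: "automorphism g" and f: "frame u v"
    and gu: "g u = a *s u" and gv: "g v = b *s v + c *s u"
  shows "a = 1 \<or> b = a\<^sup>2"
proof -
  have b0: "b \<noteq> 0"
  proof
    assume "b = 0"
    moreover have "a \<noteq> 0" using gu automorphism_0_iff[OF g, of u] f by (auto simp: frame_def)
    ultimately have "g (v + (- (c / a)) *s u) = 0"
      using gu gv by (simp add: automorphismD[OF g])
    then have "v + (- (c / a)) *s u = 0" using automorphism_0_iff[OF g] by blast
    then have "v = (c / a) *s u" by (simp add: algebra_simps)
    then show False using f by (auto simp: frame_def span_singleton)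
  qed
  obtain c1 c2 where uu: "u \<star> u = c1 *s u + c2 *s v" using frame_coordinates[OF f] .
  obtain d1 d2 where uv: "u \<star> v = d1 *s u + d2 *s v" using frame_coordinates[OF f] .
  obtain e1 e2 where vu: "v \<star> u = e1 *s u + e2 *s v" using frame_coordinates[OF f] .
  have "c2 \<noteq> 0 \<or> d2 \<noteq> 0 \<or> e2 \<noteq> 0"
    using product_leaves_line[OF f] unfolding uu uv vu by (auto simp: span_singleton)
  have "g (u \<star> u) = g u \<star> g u" "g (u \<star> v) = g u \<star> g v" "g (v \<star> u) = g v \<star> g u"
    by (simp_all add: automorphismD[OF g])
  then have
    "(c1 * a + c2 * c) *s u + (c2 * b) *s v = (a * a * c1) *s u + (a * a * c2) *s v"
    "(d1 * a + d2 * c) *s u + (d2 * b) *s v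
       = (a * b * d1 + a * c * c1) *s u + (a * b * d2 + a * c * c2) *s v"
    "(e1 * a + e2 * c) *s u + (e2 * b) *s v
       = (a * b * e1 + a * c * c1) *s u + (a * b * e2 + a * c * c2) *s v"
    unfolding uu uv vu gu gv automorphismD[OF g] prod_bilinear
    by (simp_all add: uu uv vu algebra_simps scale_left_distrib)
  then have "c2 * b = a * a * c2" "d2 * b = a * b * d2 + a * c * c2"
    "e2 * b = a * b * e2 + a * c * c2"
    unfolding frame_eq_iff[OF f] by blast+
  then have "c2 * (b - a\<^sup>2) = 0" "c2 = 0 \<Longrightarrow> d2 * b * (a - 1) = 0"
    "c2 = 0 \<Longrightarrow> e2 * b * (a - 1) = 0"
    by (simp_all add: algebra_simps power2_eq_square)
  with \<open>c2 \<noteq> 0 \<or> d2 \<noteq> 0 \<or> e2 \<noteq> 0\<close> b0 show ?thesis by fastforce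
qed

text \<open>When \<open>a \<noteq> b\<close> the map has a second eigenline, to which \<open>triangular_eigenvalues\<close> applies with the
  eigenvalues exchanged. The exponent 6 covers the surviving cases: both eigenvalues 1, one
  eigenvalue 1 and the other \<open>\<plusminus>1\<close>, or a pair \<open>a, a\<^sup>2\<close> of cube roots of unity.\<close>

lemma triangular_eigenvalues_roots_of_unity:
  assumes g: "automorphism g" and f: "frame u v"
    and gu: "g u = a *s u" and gv: "g v = b *s v + c *s u"
  shows "a ^ 6 = 1 \<and> b ^ 6 = 1"
proof -
  have a0: "a \<noteq> 0" using gu automorphism_0_iff[OF g, of u] f by (auto simp: frame_def)
  have 1: "a = 1 \<or> b = a\<^sup>2" by (rule triangular_eigenvalues[OF assms])
  show ?thesis
  proof (cases "a = b")
    case True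
    then show ?thesis using 1 a0 by (auto simp: power2_eq_square)
  next
    case False
    \<comment> \<open>The shift that makes \<open>w\<close> an eigenvector for \<open>b\<close>.\<close>
    define w where "w = v + (c / (b - a)) *s u"
    have "g w = b *s v + (c + (c / (b - a)) * a) *s u"
      by (simp add: w_def automorphismD[OF g] gu gv algebra_simps scale_left_distrib)
    also have "c + (c / (b - a)) * a = b * (c / (b - a))"
      using False by (simp add: field_simps)
    also have "b *s v + (b * (c / (b - a))) *s u = b *s w"
      by (simp add: w_def algebra_simps)
    finally have gw: "g w = b *s w" .
    have "frame u w"
      using f span_scale[OF span_base[of u "{u}"]] by (simp add: frame_def w_def span_add_eq2)
    then have "frame w u" by (rule frame_sym)
    then have 2: "b = 1 \<or> a = b\<^sup>2"
      by (rule triangular_eigenvalues[OF g _ gw, where c = 0]) (simp add: gu)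
    show ?thesis
    proof (cases "a = 1 \<or> b = 1")
      case True
      with 1 2 show ?thesis by (auto simp: power_mult[symmetric] power2_eq_1_iff)
    next
      case False
      with 1 2 have ab: "b = a\<^sup>2" "a = b\<^sup>2" by auto
      have "a * a ^ 3 = (a\<^sup>2)\<^sup>2" by (simp add: power2_eq_square power3_eq_cube mult.assoc)
      also have "\<dots> = a * 1" by (simp flip: ab)
      finally have "a * a ^ 3 = a * 1" .
      then have "a ^ 3 = 1" using a0 by simp
      then have "a ^ (3 * 2) = 1" "a ^ (3 * 4) = 1" by (simp_all only: power_mult power_one)
      moreover have "b ^ 6 = a ^ (3 * 4)" unfolding ab(1) by (simp add: power_mult[symmetric])
      ultimately show ?thesis by simp
    qed
  qed
qed

text \<open>If \<open>uu = c1 u + c2 v\<close>, invariance of \<open>uu\<close>, \<open>uv\<close> and \<open>vu\<close> forces \<open>uu = c1 u\<close> and the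
  \<open>v\<close>-coordinates of \<open>uv\<close> and \<open>vu\<close> to equal \<open>c1\<close>, so \<open>c1 \<noteq> 0\<close> as \<open>Fu\<close> is not an ideal. The
  \<open>u\<close>-coordinate of the condition on \<open>vv\<close> is then, after division by the parameter, a linear
  equation for it with leading coefficient \<open>c1\<close>. A nontrivial such automorphism can exist only in
  characteristic 2, since the \<open>v\<close>-coordinate of that condition reads \<open>2 c1 = 0\<close>.\<close>

lemma unipotent_parameter_unique:
  assumes g: "automorphism g" "g u = u" "g v = v + s *s u" "s \<noteq> 0"
    and h: "automorphism h" "h u = u" "h v = v + t *s u" "t \<noteq> 0"
    and f: "frame u v"
  shows "s = t"
proof -
  obtain c1 c2 where uu: "u \<star> u = c1 *s u + c2 *s v" using frame_coordinates[OF f] .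
  obtain d1 d2 where uv: "u \<star> v = d1 *s u + d2 *s v" using frame_coordinates[OF f] .
  obtain e1 e2 where vu: "v \<star> u = e1 *s u + e2 *s v" using frame_coordinates[OF f] .
  obtain h1 h2 where vv: "v \<star> v = h1 *s u + h2 *s v" using frame_coordinates[OF f] .
  have key: "c1 \<noteq> 0 \<and> r * c1 = h2 - d1 - e1"
    if k: "automorphism k" "k u = u" "k v = v + r *s u" "r \<noteq> 0" for k r
  proof -
    have "k (u \<star> u) = k u \<star> k u" "k (u \<star> v) = k u \<star> k v" "k (v \<star> u) = k v \<star> k u"
      "k (v \<star> v) = k v \<star> k v"
      by (simp_all add: automorphismD[OF k(1)])
    then have
      "(c1 + c2 * r) *s u + c2 *s v = c1 *s u + c2 *s v"
      "(d1 + d2 * r) *s u + d2 *s v = (d1 + r * c1) *s u + (d2 + r * c2) *s v"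
      "(e1 + e2 * r) *s u + e2 *s v = (e1 + r * c1) *s u + (e2 + r * c2) *s v"
      "(h1 + h2 * r) *s u + h2 *s v
        = (h1 + r * d1 + r * e1 + r * r * c1) *s u + (h2 + r * d2 + r * e2 + r * r * c2) *s v"
      unfolding automorphismD[OF k(1)] prod_bilinear k uu uv vu vv
      by (simp_all add: uu uv vu vv k prod_bilinear automorphismD[OF k(1)] algebra_simps scale_left_distrib)
    then have "c1 + c2 * r = c1" "d1 + d2 * r = d1 + r * c1" "e1 + e2 * r = e1 + r * c1"
      "h1 + h2 * r = h1 + r * d1 + r * e1 + r * r * c1"
      unfolding frame_eq_iff[OF f] by blast+
    then have eqs: "c2 = 0" "d2 = c1" "e2 = c1" "h2 * r = r * d1 + r * e1 + r * r * c1"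
      using k(4) by simp_all
    have "c1 \<noteq> 0"
      using product_leaves_line[OF f] unfolding uu uv vu using eqs by (auto simp: span_singleton)
    moreover have "r * h2 = r * (d1 + e1 + r * c1)" using eqs(4) by (simp add: algebra_simps)
    then have "h2 = d1 + e1 + r * c1" using k(4) by simp
    ultimately show ?thesis by simp
  qed
  show ?thesis using key[OF g] key[OF h] by (metis mult_right_cancel)
qed

lemma automorphism_eqI:
  assumes "automorphism g" "automorphism h" "frame u v" "g u = h u" "g v = h v"
  shows "g = h"
proof
  fix x
  obtain a b where "x = a *s u + b *s v" using frame_coordinates[OF assms(3)] .
  then show "g x = h x"
    using assms by (simp add: automorphismD[OF assms(1)] automorphismD[OF assms(2)])
qed

lemma finite_unipotent_automorphisms:
  assumes f: "frame u v"
  shows "finite {g. automorphism g \<and> g u = u \<and> (\<exists>t. g v = v + t *s u)}" (is "finite ?K")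
proof (cases "?K \<subseteq> {id}")
  case True
  then show ?thesis by (rule finite_subset) simp
next
  case False
  then obtain g t where g: "automorphism g" "g u = u" "g v = v + t *s u" "g \<noteq> id" by auto
  have id: "t = 0 \<Longrightarrow> h = id" if "automorphism h" "h u = u" "h v = v + t *s u" for h t
    by (rule automorphism_eqI[OF _ automorphism_id f]) (use that in auto)
  have "?K \<subseteq> {id, g}"
  proof
    fix h assume "h \<in> ?K"
    then obtain s where h: "automorphism h" "h u = u" "h v = v + s *s u" by blast
    have t0: "t \<noteq> 0" using id[of g t] g by blast
    show "h \<in> {id, g}"
    proof (cases "s = 0")
      case True
      then show ?thesis using id[OF h] by simp
    next
      case False
      then have "s = t" by (rule unipotent_parameter_unique[OF h _ g(1-3) t0 f])
      then have "h = g" using automorphism_eqI[OF h(1) g(1) f] h g by simp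
      then show ?thesis by simp
    qed
  qed
  then show ?thesis by (rule finite_subset) simp
qed

text \<open>Automorphisms in the stabilizer with the same pair of eigenvalues \<open>(a, b)\<close>, chosen below as \<open>\<phi>\<close>,
  differ by a unipotent automorphism that fixes \<open>u\<close>.\<close>

lemma finite_line_stabilizer:
  assumes "u \<noteq> 0"
  shows "finite {g. automorphism g \<and> g u \<in> span {u}}" (is "finite ?H")
proof -
  obtain v where f: "frame u v" using frame_exists[OF assms] by blast
  define \<phi> where "\<phi> g = (SOME (a, b). g u = a *s u \<and> (\<exists>c. g v = b *s v + c *s u))" for g
  have \<phi>: "\<exists>a b c. \<phi> g = (a, b) \<and> g u = a *s u \<and> g v = b *s v + c *s u" if gH: "g \<in> ?H" for g
  proof -
    obtain a where "g u = a *s u" using gH by (auto simp: span_singleton)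
    moreover obtain b c where "g v = c *s u + b *s v" using frame_coordinates[OF f] .
    ultimately have "\<exists>p. case p of (a, b) \<Rightarrow> g u = a *s u \<and> (\<exists>c. g v = b *s v + c *s u)"
      by (auto simp: add.commute)
    from someI_ex[OF this] show ?thesis unfolding \<phi>_def[symmetric] by (auto split: prod.splits)
  qed
  let ?R = "{a :: 'a. a ^ 6 = 1}"
  have "finite {a. poly (monom 1 6 - 1) a = (0 :: 'a)}"
    by (rule poly_roots_finite)
      (metis degree_1 degree_monom_eq eq_iff_diff_eq_0 one_neq_zero zero_neq_numeral)
  then have R: "finite ?R" by (simp add: poly_monom)
  show ?thesis
  proof (rule finite_automorphisms_by_fibres[where \<phi> = \<phi>])
    show "automorphism g" if "g \<in> ?H" for g using that by simp
    have "\<phi> ` ?H \<subseteq> ?R \<times> ?R"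
      using \<phi> triangular_eigenvalues_roots_of_unity[OF _ f] by fastforce
    then show "finite (\<phi> ` ?H)" using R by (meson finite_SigmaI finite_subset)
    show "finite {g. automorphism g \<and> g u = u \<and> (\<exists>t. g v = v + t *s u)}"
      by (rule finite_unipotent_automorphisms[OF f])
  next
    fix g h assume gh: "g \<in> ?H" "h \<in> ?H" "\<phi> g = \<phi> h"
    let ?i = "inv_into UNIV g"
    have ig: "?i (g x) = x" for x using automorphismD(4)[of g] gh(1) by (simp add: bij_is_inj)
    have i: "automorphism ?i" using gh(1) by (simp add: automorphism_inv)
    obtain a b c where g: "\<phi> g = (a, b)" "g u = a *s u" "g v = b *s v + c *s u"
      using \<phi>[OF gh(1)] by blast
    obtain d where h: "h u = a *s u" "h v = b *s v + d *s u"
      using \<phi>[OF gh(2)] g(1) unfolding gh(3) by auto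
    note * = g(2,3) h
    have a0: "a \<noteq> 0" using *(1) automorphism_0_iff[of g u] gh(1) assms by auto
    have "h u = g u" using * by simp
    then have 1: "?i (h u) = u" using ig by simp
    have "h v = g (v + ((d - c) / a) *s u)"
      using a0 gh(1) * by (simp add: automorphismD[of g] scale_left_diff_distrib)
    then have 2: "?i (h v) = v + ((d - c) / a) *s u" using ig by simp
    show "?i \<circ> h \<in> {g. automorphism g \<and> g u = u \<and> (\<exists>t. g v = v + t *s u)}"
      using automorphism_comp[OF i, of h] gh(2) 1 2 by auto
  qed
qed

lemma finite_automorphisms_if_finite_orbit:
  assumes u: "u \<noteq> 0" and fin: "finite {span {g u} | g. automorphism g}"
  shows "finite {g. automorphism g}"
proof (rule finite_automorphisms_by_fibres[where \<phi> = "\<lambda>g. span {g u}"])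
  show "finite ((\<lambda>g. span {g u}) ` {g. automorphism g})"
    using fin by (simp add: setcompr_eq_image)
  show "finite {g. automorphism g \<and> g u \<in> span {u}}" by (rule finite_line_stabilizer[OF u])
next
  fix g h assume gh: "g \<in> {g. automorphism g}" "h \<in> {g. automorphism g}" "span {g u} = span {h u}"
  then have "h u \<in> span {g u}" by (simp add: span_base)
  then obtain k where "h u = g (k *s u)"
    using gh(1) by (auto simp: span_singleton automorphismD)
  moreover have "bij g" using gh(1) by (simp add: automorphismD)
  ultimately have "inv_into UNIV g (h u) = k *s u" by (simp add: bij_is_inj)
  then show "inv_into UNIV g \<circ> h \<in> {g. automorphism g \<and> g u \<in> span {u}}"
    using gh automorphism_comp[OF automorphism_inv, of g h] by (auto simp: span_singleton)
qed simp

lemma finite_automorphisms_if_invariant_lines: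
  assumes inv: "\<And>g x. automorphism g \<Longrightarrow> x \<in> S \<Longrightarrow> g x \<in> S"
    and u: "u \<in> S" "u \<noteq> 0"
    and fin: "finite ((\<lambda>x. span {x}) ` (S - {0}))"
  shows "finite {g. automorphism g}"
proof (rule finite_automorphisms_if_finite_orbit[OF u(2)])
  have "{span {g u} | g. automorphism g} \<subseteq> (\<lambda>x. span {x}) ` (S - {0})"
    using inv u automorphism_0_iff by fastforce
  then show "finite {span {g u} | g. automorphism g}" using fin by (rule finite_subset)
qed

section \<open>Lines containing the squares of their elements\<close>

text \<open>Writing \<open>uu = pu\<close> and \<open>vv = qv\<close>, the condition on \<open>u + tv\<close> is, for \<open>t \<noteq> 0\<close>, an equation of
  degree one in \<open>t\<close>. Two nonzero values of \<open>t\<close> suffice to compare coefficients, which is the reason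
  for the element \<open>s\<close> (the field with two elements has none). The outcome is \<open>uv + vu = qu + pv\<close>, that is
  \<open>xx = \<lambda>(x)x\<close> with the linear form \<open>\<lambda>(au + bv) = ap + bq\<close>. The vector \<open>n\<close> spans its kernel.\<close>

lemma square_zero_line_if_squares_in_lines:
  assumes sq: "\<And>x. x \<star> x \<in> span {x}"
    and s: "s \<noteq> 0" "s \<noteq> (1 :: 'a)"
  obtains n where "n \<noteq> 0" "n \<star> n = 0" "\<And>x. x \<star> x = 0 \<Longrightarrow> x \<in> span {n}"
proof -
  obtain z where "z \<noteq> (0 :: 'b)" using simple unfolding simple_def by blast
  then obtain u v where f: "frame z u" "frame u v"
    by (metis frame_exists frame_sym frame_def)
  obtain p where uu: "u \<star> u = p *s u" using sq[of u] by (auto simp: span_singleton)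
  obtain q where vv: "v \<star> v = q *s v" using sq[of v] by (auto simp: span_singleton)
  obtain d1 d2 where uv: "u \<star> v = d1 *s u + d2 *s v" using frame_coordinates[OF f(2)] .
  obtain e1 e2 where vu: "v \<star> u = e1 *s u + e2 *s v" using frame_coordinates[OF f(2)] .
  have rel: "p + t * (d1 + e1) = d2 + e2 + t * q" if t: "t \<noteq> 0" for t
  proof -
    obtain k where "(u + t *s v) \<star> (u + t *s v) = k *s (u + t *s v)"
      using sq[of "u + t *s v"] by (auto simp: span_singleton)
    then have "(p + t * (d1 + e1)) *s u + (t * (d2 + e2) + t * t * q) *s v = k *s u + (k * t) *s v"
      unfolding prod_bilinear uu vv uv vu by (simp add: algebra_simps scale_left_distrib)
    then have "p + t * (d1 + e1) = k" "t * (d2 + e2) + t * t * q = k * t"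
      unfolding frame_eq_iff[OF f(2)] by blast+
    then have "t * (d2 + e2 + t * q) = t * (p + t * (d1 + e1))" by (simp add: algebra_simps)
    then show ?thesis using t by simp
  qed
  have "(s - 1) * (d1 + e1 - q) = (p + s * (d1 + e1)) - (p + 1 * (d1 + e1)) - (s * q - 1 * q)"
    by (simp add: algebra_simps)
  also have "\<dots> = 0" unfolding rel[OF s(1)] rel[OF one_neq_zero] by simp
  finally have "(s - 1) * (d1 + e1 - q) = 0" .
  then have "d1 + e1 - q = 0" using s(2) by simp
  then have e1: "e1 = q - d1" by (simp add: algebra_simps)
  then have e2: "e2 = p - d2" using rel[of 1] by (simp add: algebra_simps)
  have square: "(a *s u + b *s v) \<star> (a *s u + b *s v) = (a * p + b * q) *s (a *s u + b *s v)" for a b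
    unfolding prod_bilinear uu vv uv vu e1 e2
    by (simp add: algebra_simps scale_left_distrib scale_left_diff_distrib)
  have pq: "p \<noteq> 0 \<or> q \<noteq> 0"
  proof (rule ccontr)
    assume "\<not> ?thesis"
    then have 0: "p = 0" "q = 0" by auto
    have "v \<star> u = (- 1) *s (u \<star> v)" unfolding uv vu e1 e2 0 by simp
    then have *: "u \<star> u \<in> span {u \<star> v}" "v \<star> v \<in> span {u \<star> v}" "u \<star> v \<in> span {u \<star> v}"
      "v \<star> u \<in> span {u \<star> v}"
      unfolding uu vv 0 by (auto intro: span_base span_scale span_zero span_neg)
    have "x \<star> y \<in> span {u \<star> v}" for x y
    proof -
      obtain a b where x: "x = a *s u + b *s v" using frame_coordinates[OF f(2)] .
      obtain c d where y: "y = c *s u + d *s v" using frame_coordinates[OF f(2)] .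
      show ?thesis unfolding x y prod_bilinear by (intro span_add span_scale *)
    qed
    then show False by (rule products_not_in_line)
  qed
  define n where "n = q *s u + (- p) *s v"
  have comb0: "a *s u + b *s v = 0 \<longleftrightarrow> a = 0 \<and> b = 0" for a b
    using frame_eq_iff[OF f(2), of a b 0 0] by simp
  show ?thesis
  proof (rule that)
    show "n \<noteq> 0" unfolding n_def comb0 using pq by auto
    show "n \<star> n = 0" unfolding n_def square by (simp add: mult.commute)
    fix x assume x0: "x \<star> x = 0"
    obtain a b where x: "x = a *s u + b *s v" using frame_coordinates[OF f(2)] .
    have ab: "a * p + b * q = 0"
      using x0 unfolding x square scale_eq_0_iff comb0 by auto
    show "x \<in> span {n}"
    proof (cases "p = 0")
      case True
      then have "b = 0" using ab pq by simp
      then have "x = (a / q) *s n" unfolding x n_def using True pq by simp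
      then show ?thesis by (auto simp: span_singleton)
    next
      case False
      then have "a = - (b / p) * q" using ab by (simp add: field_simps eq_neg_iff_add_eq_0)
      then have "x = (- (b / p)) *s n" unfolding x n_def using False by (simp add: algebra_simps)
      then show ?thesis unfolding span_singleton_iff by blast
    qed
  qed
qed

end

locale alg_closed_simple_plane_algebra = simple_plane_algebra scale prod
  for scale :: "'a::alg_closed_field \<Rightarrow> 'b::ab_group_add \<Rightarrow> 'b" (infixr \<open>*s\<close> 75)
    and prod :: "'b \<Rightarrow> 'b \<Rightarrow> 'b" (infixl \<open>\<star>\<close> 70)
begin

text \<open>The line \<open>Fv\<close> itself is excluded, so all candidates are spanned by vectors \<open>u + tv\<close>. For these the
  condition is the vanishing of the determinant of \<open>u + tv\<close> and its square, a polynomial in \<open>t\<close>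
  whose coefficient at \<open>t\<^sup>3\<close> is the \<open>u\<close>-coordinate of \<open>vv\<close>, up to sign. As \<open>vv \<notin> Fv\<close>, this
  coefficient does not vanish.\<close>

lemma finitely_many_lines_containing_squares:
  assumes v: "v \<star> v \<notin> span {v}"
  defines "S \<equiv> {x. x \<star> x \<in> span {x}}"
  shows "\<exists>x\<in>S. x \<noteq> 0" and "finite ((\<lambda>x. span {x}) ` (S - {0}))"
proof -
  have "v \<noteq> 0" using v prod_scale_left[of 0 v v] span_zero by auto
  then obtain u where "frame v u" using frame_exists by blast
  then have f: "frame u v" by (rule frame_sym)
  obtain c1 c2 where uu: "u \<star> u = c1 *s u + c2 *s v" using frame_coordinates[OF f] .
  obtain d1 d2 where uv: "u \<star> v = d1 *s u + d2 *s v" using frame_coordinates[OF f] .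
  obtain e1 e2 where vu: "v \<star> u = e1 *s u + e2 *s v" using frame_coordinates[OF f] .
  obtain h1 h2 where vv: "v \<star> v = h1 *s u + h2 *s v" using frame_coordinates[OF f] .
  have h1: "h1 \<noteq> 0" using v unfolding vv by (auto simp: span_singleton)
  define P where "P = [:- c2, c1 - d2 - e2, d1 + e1 - h2, h1:]"
  have P: "u + t *s v \<in> S \<longleftrightarrow> poly P t = 0" for t
  proof -
    define A B where "A = c1 + t * (d1 + e1) + t * t * h1" and "B = c2 + t * (d2 + e2) + t * t * h2"
    have sq: "(u + t *s v) \<star> (u + t *s v) = A *s u + B *s v"
      unfolding prod_bilinear uu uv vu vv A_def B_def by (simp add: algebra_simps scale_left_distrib)
    have "A *s u + B *s v = k *s (u + t *s v) \<longleftrightarrow> A = k \<and> B = k * t" for k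
      using frame_eq_iff[OF f, of A B k "k * t"] by (simp add: scale_right_distrib)
    then have "u + t *s v \<in> S \<longleftrightarrow> B = A * t"
      unfolding S_def mem_Collect_eq sq span_singleton_iff by auto
    also have "\<dots> \<longleftrightarrow> A * t - B = 0" by (metis eq_iff_diff_eq_0)
    also have "A * t - B = poly P t" by (simp add: A_def B_def P_def algebra_simps)
    finally show ?thesis .
  qed
  have "degree P = 3" using h1 by (simp add: P_def)
  then obtain t where "poly P t = 0" using alg_closed_imp_poly_has_root[of P] by auto
  then have "u + t *s v \<in> S" using P by simp
  moreover have "u + t *s v \<noteq> 0" using frame_eq_iff[OF f, of 1 t 0 0] by simp
  ultimately show "\<exists>x\<in>S. x \<noteq> 0" by blast
  have "P \<noteq> 0" using h1 by (simp add: P_def)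
  then have fin: "finite {t. poly P t = 0}" by (rule poly_roots_finite)
  have "(\<lambda>x. span {x}) ` (S - {0}) \<subseteq> (\<lambda>t. span {u + t *s v}) ` {t. poly P t = 0}"
  proof (rule image_subsetI)
    fix x assume "x \<in> S - {0}"
    then have x: "x \<in> S" "x \<noteq> 0" by auto
    have scale_S: "k *s x \<in> S" for k
      using square_in_line_scale[of x k] x(1) by (simp add: S_def)
    obtain a b where ab: "x = a *s u + b *s v" using frame_coordinates[OF f] .
    have "a \<noteq> 0"
    proof
      assume "a = 0"
      then have xb: "x = b *s v" "b \<noteq> 0" using ab x(2) by auto
      then have "v = inverse b *s x" by simp
      then have "v \<in> S" using scale_S by metis
      then show False using v by (simp add: S_def)
    qed
    then have 1: "u + (b / a) *s v = inverse a *s x"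
      unfolding ab by (simp add: scale_right_distrib divide_inverse mult.commute)
    then have "poly P (b / a) = 0" using P scale_S by metis
    moreover have "span {x} = span {u + (b / a) *s v}"
      unfolding 1 using \<open>a \<noteq> 0\<close> by (simp add: span_scaled_singleton)
    ultimately show "span {x} \<in> (\<lambda>t. span {u + t *s v}) ` {t. poly P t = 0}" by blast
  qed
  then show "finite ((\<lambda>x. span {x}) ` (S - {0}))" using fin finite_surj by blast
qed

section \<open>Finiteness of the automorphism group\<close>

lemma finite_automorphisms: "finite {g. automorphism g}"
proof (cases "\<forall>x. x \<star> x \<in> span {x}")
  case True
  \<comment> \<open>A root of \<open>X\<^sup>2 - X - 1\<close> differs from 0 and 1 in every characteristic.\<close>
  have "\<exists>s :: 'a. poly [:- 1, - 1, 1:] s = 0"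
    by (rule alg_closed_imp_poly_has_root) simp
  then obtain s :: 'a where "poly [:- 1, - 1, 1:] s = 0" by blast
  then have "s \<noteq> 0" "s \<noteq> 1" by auto
  then obtain n where n: "n \<noteq> 0" "n \<star> n = 0" "\<And>x. x \<star> x = 0 \<Longrightarrow> x \<in> span {n}"
    using square_zero_line_if_squares_in_lines True by metis
  have "g n \<in> span {n}" if g: "automorphism g" for g
  proof (rule n(3))
    have "g n \<star> g n = g (n \<star> n)" by (simp add: automorphismD[OF g])
    then show "g n \<star> g n = 0" using n(2) automorphism_0_iff[OF g] by simp
  qed
  then have "{g. automorphism g} \<subseteq> {g. automorphism g \<and> g n \<in> span {n}}" by blast
  then show ?thesis using finite_line_stabilizer[OF n(1)] by (rule finite_subset)
next
  case False
  then obtain v where v: "v \<star> v \<notin> span {v}" by blast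
  obtain x where x: "x \<in> {x. x \<star> x \<in> span {x}}" "x \<noteq> 0"
    using finitely_many_lines_containing_squares(1)[OF v] by blast
  show ?thesis
    by (rule finite_automorphisms_if_invariant_lines[OF _ x
          finitely_many_lines_containing_squares(2)[OF v]])
      (simp add: automorphism_square_in_line)
qed

end

theorem corollary6p4:
  fixes scale :: "'a::alg_closed_field \<Rightarrow> 'b::ab_group_add \<Rightarrow> 'b"
    and prod :: "'b \<Rightarrow> 'b \<Rightarrow> 'b"
  assumes "nonassoc_algebra scale prod"
    and "vector_space.dim scale (UNIV :: 'b set) = 2"
    and "nonassoc_algebra.simple scale prod"
  shows "finite (carrier (nonassoc_algebra.automorphism_group scale prod))"
proof -
  interpret nonassoc_algebra scale prod by fact
  interpret alg_closed_simple_plane_algebra scale prod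
    by unfold_locales fact+
  show ?thesis
    using finite_automorphisms by (simp add: automorphism_group_def)
qed

end
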